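(* Let $\sigma_1,\sigma_2$ be weight functions on $T$, let $\varphi:T\to T$ be a self map and $\psi:T\to\mathbb{C}$ a function, and let $0<p<\infty$. For each $m,n\in\mathbb{N}_0$ choose $v_{m,n}\in D_m$ with $N_\varphi(n,v_{m,n})=N_{m,n}$. Consider $W_{\psi,\varphi}(f)=\psi\,(f\circ\varphi)$. (i) If $W_{\psi,\varphi}:\mathbb{T}_{\sigma_1,p}\to\mathbb{T}_{\sigma_2,p}$ is a bounded operator, then $$\sup_{n\in\mathbb{N}_0}\left(\frac{1}{c_n}\sum_{m\in[\varphi(D_n)]}\ \sum_{|x|=n,\ \varphi(x)=v_{m,n}}\left|\frac{\sigma_2(x)\psi(x)}{\sigma_1(\varphi(x))}\right|^p c_m\right)\le\|W_{\psi,\varphi}\|^p.$$ (ii) If $$M=\sup_{n\in\mathbb{N}_0}\left(\frac{1}{c_n}\sum_{m\in[\varphi(D_n)]}\ \sum_{|x|=n,\ |\varphi(x)|=m}\left|\frac{\sigma_2(x)\psi(x)}{\sigma_1(\varphi(x))}\right|^p c_m\right)<\infty,$$ then $W_{\psi,\varphi}:\mathbb{T}_{\sigma_1,p}\to\mathbb{T}_{\sigma_2,p}$ is a bounded operator with $\|W_{\psi,\varphi}\|^p\le M$.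
   Context: $T$ is an infinite rooted tree, identified with its vertex set; $|x|$ is the edge-counting distance from the root $o$ to the vertex $x$; $D_n=\{x\in T:|x|=n\}$ and $c_n$ is the number of elements of $D_n$ for $n\in\mathbb{N}_0=\{0,1,2,\dots\}$. Standing assumptions: every $c_n$ is finite and the sequence $\{c_n\}$ is unbounded. A weight function is a function $\sigma:T\to(0,\infty)$. For a weight $\sigma$, $0<p<\infty$ and $f:T\to\mathbb{C}$, put $M_{\sigma,p}(n,f)=\left(\frac{1}{c_n}\sum_{|x|=n}\sigma(x)^p|f(x)|^p\right)^{1/p}$ and $\|f\|_{\sigma,p}=\sup_{n\in\mathbb{N}_0}M_{\sigma,p}(n,f)$. The space $\mathbb{T}_{\sigma,p}$ is the set of all $f:T\to\mathbb{C}$ with $\|f\|_{\sigma,p}<\infty$. A linear operator $A:X\to Y$ between such spaces is bounded if it maps $X$ into $Y$ and $\|Af\|_Y\le C\|f\|_X$ for some constant $C$ and all $f\in X$; $\|A\|$ is the least such $C$. Further notation: $[\varphi(D_n)]$ is the set $\{|\varphi(x)|:x\in D_n\}\subseteq\mathbb{N}_0$; for $w\in T$, $n\in\mathbb{N}_0$, $N_\varphi(n,w)$ is the number of elements of $\varphi^{-1}(w)\cap D_n$; and $N_{m,n}=\max_{|w|=m}N_\varphi(n,w)$. *)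

theory Defs
  imports "HOL-Analysis.Analysis"
begin

(* A tree is given by its adjacency relation on the type of its vertices, so the vertex set T is
   the whole type 'v and functions on T are plain functions on 'v. *)

definition graph_cycle :: "('v \<Rightarrow> 'v \<Rightarrow> bool) \<Rightarrow> 'v list \<Rightarrow> bool" where
  "graph_cycle adj xs \<longleftrightarrow>
     length xs \<ge> 3 \<and> distinct xs \<and> successively adj xs \<and> adj (last xs) (hd xs)"

definition is_tree :: "('v \<Rightarrow> 'v \<Rightarrow> bool) \<Rightarrow> bool" where
  "is_tree adj \<longleftrightarrow>
     symp adj \<and> irreflp adj \<and> (\<forall>x y. adj\<^sup>*\<^sup>* x y) \<and> (\<nexists>xs. graph_cycle adj xs)"

definition depth :: "('v \<Rightarrow> 'v \<Rightarrow> bool) \<Rightarrow> 'v \<Rightarrow> 'v \<Rightarrow> nat" where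
  "depth adj r x = (LEAST n. (adj ^^ n) r x)"

definition level :: "('v \<Rightarrow> 'v \<Rightarrow> bool) \<Rightarrow> 'v \<Rightarrow> nat \<Rightarrow> 'v set" where
  "level adj r n = {x. depth adj r x = n}"

definition level_card :: "('v \<Rightarrow> 'v \<Rightarrow> bool) \<Rightarrow> 'v \<Rightarrow> nat \<Rightarrow> nat" where
  "level_card adj r n = card (level adj r n)"

definition weight_function :: "('v \<Rightarrow> real) \<Rightarrow> bool" where
  "weight_function \<sigma> \<longleftrightarrow> (\<forall>x. \<sigma> x > 0)"

definition level_mean ::
  "('v \<Rightarrow> 'v \<Rightarrow> bool) \<Rightarrow> 'v \<Rightarrow> ('v \<Rightarrow> real) \<Rightarrow> real \<Rightarrow> nat \<Rightarrow> ('v \<Rightarrow> complex) \<Rightarrow> real" where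
  "level_mean adj r \<sigma> p n f =
     (1 / real (level_card adj r n) *
       (\<Sum>x\<in>level adj r n. \<sigma> x powr p * cmod (f x) powr p)) powr (1 / p)"

definition T_norm ::
  "('v \<Rightarrow> 'v \<Rightarrow> bool) \<Rightarrow> 'v \<Rightarrow> ('v \<Rightarrow> real) \<Rightarrow> real \<Rightarrow> ('v \<Rightarrow> complex) \<Rightarrow> ereal" where
  "T_norm adj r \<sigma> p f = (SUP n. ereal (level_mean adj r \<sigma> p n f))"

(* A space of functions is represented by its extended-valued (quasi-)norm N: its elements are
   the functions of finite N, so that for N = T_norm adj r \<sigma> p it is the space T_{\<sigma>,p}. *)

definition fspace :: "(('v \<Rightarrow> complex) \<Rightarrow> ereal) \<Rightarrow> ('v \<Rightarrow> complex) set" where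
  "fspace N = {f. N f < \<infinity>}"

definition linear_on_fspace ::
  "(('v \<Rightarrow> complex) \<Rightarrow> ereal) \<Rightarrow> (('v \<Rightarrow> complex) \<Rightarrow> ('v \<Rightarrow> complex)) \<Rightarrow> bool" where
  "linear_on_fspace N A \<longleftrightarrow>
     (\<forall>f\<in>fspace N. \<forall>g\<in>fspace N. A (\<lambda>x. f x + g x) = (\<lambda>x. A f x + A g x)) \<and>
     (\<forall>f\<in>fspace N. \<forall>a. A (\<lambda>x. a * f x) = (\<lambda>x. a * A f x))"

definition op_bound ::
  "(('v \<Rightarrow> complex) \<Rightarrow> ereal) \<Rightarrow> (('v \<Rightarrow> complex) \<Rightarrow> ereal) \<Rightarrow>
   (('v \<Rightarrow> complex) \<Rightarrow> ('v \<Rightarrow> complex)) \<Rightarrow> real \<Rightarrow> bool" where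
  "op_bound N\<^sub>X N\<^sub>Y A C \<longleftrightarrow> (\<forall>f\<in>fspace N\<^sub>X. N\<^sub>Y (A f) \<le> ereal C * N\<^sub>X f)"

definition bounded_operator ::
  "(('v \<Rightarrow> complex) \<Rightarrow> ereal) \<Rightarrow> (('v \<Rightarrow> complex) \<Rightarrow> ereal) \<Rightarrow>
   (('v \<Rightarrow> complex) \<Rightarrow> ('v \<Rightarrow> complex)) \<Rightarrow> bool" where
  "bounded_operator N\<^sub>X N\<^sub>Y A \<longleftrightarrow>
     linear_on_fspace N\<^sub>X A \<and> A ` fspace N\<^sub>X \<subseteq> fspace N\<^sub>Y \<and> (\<exists>C. op_bound N\<^sub>X N\<^sub>Y A C)"

(* The least bound exists (and is nonnegative) for every bounded operator between the spaces
   T_{\<sigma>,p}: such a space contains the indicator of the root, whose norm is positive, and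
   the set of bounds is closed. *)
definition operator_norm ::
  "(('v \<Rightarrow> complex) \<Rightarrow> ereal) \<Rightarrow> (('v \<Rightarrow> complex) \<Rightarrow> ereal) \<Rightarrow>
   (('v \<Rightarrow> complex) \<Rightarrow> ('v \<Rightarrow> complex)) \<Rightarrow> real" where
  "operator_norm N\<^sub>X N\<^sub>Y A = (LEAST C. op_bound N\<^sub>X N\<^sub>Y A C)"

definition weighted_comp ::
  "('v \<Rightarrow> complex) \<Rightarrow> ('v \<Rightarrow> 'v) \<Rightarrow> ('v \<Rightarrow> complex) \<Rightarrow> ('v \<Rightarrow> complex)" where
  "weighted_comp \<psi> \<phi> f = (\<lambda>x. \<psi> x * f (\<phi> x))"

definition image_levels :: "('v \<Rightarrow> 'v \<Rightarrow> bool) \<Rightarrow> 'v \<Rightarrow> ('v \<Rightarrow> 'v) \<Rightarrow> nat \<Rightarrow> nat set" where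
  "image_levels adj r \<phi> n = (\<lambda>x. depth adj r (\<phi> x)) ` level adj r n"

definition preimage_count ::
  "('v \<Rightarrow> 'v \<Rightarrow> bool) \<Rightarrow> 'v \<Rightarrow> ('v \<Rightarrow> 'v) \<Rightarrow> nat \<Rightarrow> 'v \<Rightarrow> nat" where
  "preimage_count adj r \<phi> n w = card (\<phi> -` {w} \<inter> level adj r n)"

definition max_preimage_count ::
  "('v \<Rightarrow> 'v \<Rightarrow> bool) \<Rightarrow> 'v \<Rightarrow> ('v \<Rightarrow> 'v) \<Rightarrow> nat \<Rightarrow> nat \<Rightarrow> nat" where
  "max_preimage_count adj r \<phi> m n =
     Max (preimage_count adj r \<phi> n ` level adj r m)"

end

(* The test function for (i) takes the value c_m^(1/p) / sigma_1 at one chosen vertex v_(m,n) of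
   each level D_m and vanishes elsewhere.  All its level means equal 1, and the n-th level mean of
   its image, raised to the power p, is exactly the n-th term of the supremum.  For (ii), the
   level mean over D_m controls each single term,
   sigma_1(w)^p |f(w)|^p <= c_m ||f||^p for |w| = m, and the sum over D_n is grouped by |phi(x)|. *)
theory Submission
  imports Defs
begin

text \<open>\<open>LEAST\<close> on the reals carries information only once a least element is
  exhibited. The function \<open>f0\<close> of positive finite norm makes every bound nonnegative,
  so the bounds have an infimum; for each fixed function the bounding inequality is closed in the
  constant, so the infimum is itself a bound.\<close>

lemma operator_norm_least:
  assumes NX: "\<And>f. 0 \<le> N\<^sub>X f" and NY: "\<And>f. 0 \<le> N\<^sub>Y f"
    and f0: "f0 \<in> fspace N\<^sub>X" "0 < N\<^sub>X f0"
    and C0: "op_bound N\<^sub>X N\<^sub>Y A C0"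
  shows op_bound_operator_norm: "op_bound N\<^sub>X N\<^sub>Y A (operator_norm N\<^sub>X N\<^sub>Y A)"
    and operator_norm_nonneg: "0 \<le> operator_norm N\<^sub>X N\<^sub>Y A"
    and operator_norm_le: "op_bound N\<^sub>X N\<^sub>Y A C \<Longrightarrow> operator_norm N\<^sub>X N\<^sub>Y A \<le> C"
proof -
  define S where "S = {C. op_bound N\<^sub>X N\<^sub>Y A C}"
  have pos: "0 \<le> C" if "C \<in> S" for C
  proof (rule ccontr)
    assume "\<not> 0 \<le> C"
    then have "ereal C * N\<^sub>X f0 < 0"
      using f0(2) by (simp add: ereal_mult_less_0_iff)
    moreover have "N\<^sub>Y (A f0) \<le> ereal C * N\<^sub>X f0"
      using that f0(1) by (auto simp: S_def op_bound_def)
    ultimately show False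
      using NY[of "A f0"] by (meson leD order_trans)
  qed
  have bdd: "bdd_below S"
    using pos by (rule bdd_belowI)
  have ne: "S \<noteq> {}"
    using C0 by (auto simp: S_def)
  have bound: "op_bound N\<^sub>X N\<^sub>Y A (Inf S)"
    unfolding op_bound_def
  proof
    fix f assume f: "f \<in> fspace N\<^sub>X"
    then obtain a where a: "N\<^sub>X f = ereal a" "0 \<le> a"
      using NX[of f] by (cases "N\<^sub>X f") (auto simp: fspace_def)
    have le: "N\<^sub>Y (A f) \<le> ereal (C * a)" if "C \<in> S" for C
      using that f a(1) by (auto simp: S_def op_bound_def)
    then obtain b where b: "N\<^sub>Y (A f) = ereal b"
      using NY[of "A f"] ne by (cases "N\<^sub>Y (A f)") force+
    \<comment> \<open>For a > 0 the quotient b / a is a lower bound of \<open>S\<close>. For a = 0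
      no division is possible, but any single bound already forces b \<le> 0.\<close>
    have "b \<le> Inf S * a"
    proof (cases "a = 0")
      case True
      then show ?thesis using le b ne by force
    next
      case False
      then have "b / a \<le> C" if "C \<in> S" for C
        using le[OF that] a(2) b by (simp add: divide_le_eq)
      then have "b / a \<le> Inf S" by (intro cInf_greatest ne)
      then show ?thesis using False a(2) by (simp add: divide_le_eq)
    qed
    then show "N\<^sub>Y (A f) \<le> ereal (Inf S) * N\<^sub>X f"
      using a b by simp
  qed
  have eq: "operator_norm N\<^sub>X N\<^sub>Y A = Inf S"
    unfolding operator_norm_def
    by (rule Least_equality) (use bound bdd in \<open>auto intro: cInf_lower simp: S_def\<close>)
  show "op_bound N\<^sub>X N\<^sub>Y A (operator_norm N\<^sub>X N\<^sub>Y A)"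
    using bound eq by simp
  show "0 \<le> operator_norm N\<^sub>X N\<^sub>Y A"
    unfolding eq by (rule cInf_greatest[OF ne pos])
  show "operator_norm N\<^sub>X N\<^sub>Y A \<le> C" if "op_bound N\<^sub>X N\<^sub>Y A C"
    using that bdd unfolding eq by (auto intro: cInf_lower simp: S_def)
qed

lemma level_mean_nonneg: "0 \<le> level_mean adj r \<sigma> p n f"
  by (simp add: level_mean_def)

lemma level_mean_powr:
  assumes "0 < p"
  shows "level_mean adj r \<sigma> p n f powr p =
    1 / real (level_card adj r n) * (\<Sum>x\<in>level adj r n. \<sigma> x powr p * cmod (f x) powr p)"
  using assms by (simp add: level_mean_def powr_powr sum_nonneg)

lemma level_mean_le_T_norm: "ereal (level_mean adj r \<sigma> p n f) \<le> T_norm adj r \<sigma> p f"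
  unfolding T_norm_def by (rule SUP_upper) simp

lemma T_norm_nonneg: "0 \<le> T_norm adj r \<sigma> p f"
  using level_mean_nonneg level_mean_le_T_norm
  by (metis ereal_less_eq(5) order_trans)

lemma linear_on_fspace_weighted_comp: "linear_on_fspace N (weighted_comp \<psi> \<phi>)"
  by (simp add: linear_on_fspace_def weighted_comp_def algebra_simps)

text \<open>Dividing and multiplying by \<sigma>_1 at \<phi>(x) splits each summand into the
  multiplier that occurs in both suprema and a summand of the level mean of \<open>f\<close> at
  \<phi>(x). Both halves of the theorem then only have to treat the second factor.\<close>

lemma level_mean_weighted_comp:
  assumes "weight_function \<sigma>\<^sub>1" "weight_function \<sigma>\<^sub>2" "0 < p" "finite (level adj r n)"
  shows "level_mean adj r \<sigma>\<^sub>2 p n (weighted_comp \<psi> \<phi> f) powr p =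
    1 / real (level_card adj r n) *
      (\<Sum>m\<in>image_levels adj r \<phi> n. \<Sum>x\<in>{x \<in> level adj r n. depth adj r (\<phi> x) = m}.
        cmod (of_real (\<sigma>\<^sub>2 x) * \<psi> x / of_real (\<sigma>\<^sub>1 (\<phi> x))) powr p *
        (\<sigma>\<^sub>1 (\<phi> x) powr p * cmod (f (\<phi> x)) powr p))"
    (is "_ = _ * (\<Sum>m\<in>_. \<Sum>x\<in>_. ?g x)")
proof -
  have pos: "\<sigma>\<^sub>1 x > 0" "\<sigma>\<^sub>2 x > 0" for x
    using assms(1,2) by (auto simp: weight_function_def)
  have "\<sigma>\<^sub>2 x powr p * cmod (weighted_comp \<psi> \<phi> f x) powr p = ?g x" for x
    using pos[of x] pos[of "\<phi> x"]
    by (simp add: weighted_comp_def norm_mult norm_divide powr_mult powr_divide less_imp_le)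
  \<comment> \<open>The fibres of x \<mapsto> |\<phi>(x)| partition the finite level, indexed by
    exactly the members of \<open>image_levels\<close>.\<close>
  moreover have "(\<Sum>m\<in>image_levels adj r \<phi> n.
      \<Sum>x\<in>{x \<in> level adj r n. depth adj r (\<phi> x) = m}. ?g x) = (\<Sum>x\<in>level adj r n. ?g x)"
    by (rule sum.group) (use assms(4) in \<open>auto simp: image_levels_def\<close>)
  ultimately show ?thesis
    by (simp add: level_mean_powr[OF assms(3)])
qed

text \<open>The condition \<open>w = s (depth adj r w)\<close> selects at most one vertex per level.
  The root c^(1/p) is chosen so that the weighted p-th power is the level size, which cancels the
  averaging factor.\<close>

definition transversal_fun ::
  "('v \<Rightarrow> 'v \<Rightarrow> bool) \<Rightarrow> 'v \<Rightarrow> ('v \<Rightarrow> real) \<Rightarrow> real \<Rightarrow> (nat \<Rightarrow> 'v) \<Rightarrow> 'v \<Rightarrow> complex" where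
  "transversal_fun adj r \<sigma> p s w =
     (if w = s (depth adj r w)
      then of_real (real (level_card adj r (depth adj r w)) powr (1 / p) / \<sigma> w) else 0)"

lemma transversal_fun_powr:
  assumes "weight_function \<sigma>" "0 < p"
  shows "\<sigma> w powr p * cmod (transversal_fun adj r \<sigma> p s w) powr p =
    (if w = s (depth adj r w) then real (level_card adj r (depth adj r w)) else 0)"
proof -
  have "\<sigma> w > 0"
    using assms(1) by (simp add: weight_function_def)
  then show ?thesis
    using assms(2)
    by (simp add: transversal_fun_def norm_divide powr_divide powr_powr less_imp_le)
qed

lemma T_norm_transversal_fun:
  assumes \<sigma>: "weight_function \<sigma>" "0 < p"
    and fin: "\<And>n. finite (level adj r n)" and s: "\<And>n. s n \<in> level adj r n"
  shows "T_norm adj r \<sigma> p (transversal_fun adj r \<sigma> p s) = 1"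
proof -
  have "level_mean adj r \<sigma> p n (transversal_fun adj r \<sigma> p s) = 1" for n
  proof -
    have "(\<Sum>x\<in>level adj r n. \<sigma> x powr p * cmod (transversal_fun adj r \<sigma> p s x) powr p)
        = (\<Sum>x\<in>level adj r n. if x = s n then real (level_card adj r n) else 0)"
      by (rule sum.cong) (auto simp: transversal_fun_powr[OF \<sigma>] level_def)
    also have "\<dots> = real (level_card adj r n)"
      using fin s by simp
    finally have sum: "(\<Sum>x\<in>level adj r n. \<sigma> x powr p *
        cmod (transversal_fun adj r \<sigma> p s x) powr p) = real (level_card adj r n)" .
    \<comment> \<open>Were the cardinality 0, the convention 1 / 0 = 0 would turn the mean into 0;
      the vertex \<open>s n\<close> of the finite level excludes this.\<close>
    have "level_card adj r n \<noteq> 0"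
      using fin[of n] s[of n] by (auto simp: level_card_def)
    then show ?thesis
      unfolding level_mean_def sum by simp
  qed
  then show ?thesis
    by (simp add: T_norm_def one_ereal_def)
qed

text \<open>A nonnegative summand is at most the full sum over its level, and that sum is the level
  size times the p-th power of the level mean.\<close>

lemma level_term_le:
  assumes p: "0 < p" and fin: "finite (level adj r (depth adj r w))"
    and F: "T_norm adj r \<sigma> p f \<le> ereal F"
  shows "\<sigma> w powr p * cmod (f w) powr p \<le> real (level_card adj r (depth adj r w)) * F powr p"
proof -
  define m where "m = depth adj r w"
  have w: "w \<in> level adj r m"
    by (simp add: level_def m_def)
  then have card: "real (level_card adj r m) > 0"
    using fin by (auto simp: level_card_def m_def card_gt_0_iff)
  have "level_mean adj r \<sigma> p m f \<le> F"
    using order_trans[OF level_mean_le_T_norm F] by simp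
  then have "level_mean adj r \<sigma> p m f powr p \<le> F powr p"
    using p level_mean_nonneg by (intro powr_mono2) auto
  then have "(\<Sum>x\<in>level adj r m. \<sigma> x powr p * cmod (f x) powr p)
      \<le> real (level_card adj r m) * F powr p"
    using card by (simp add: level_mean_powr[OF p] field_simps)
  moreover have "\<sigma> w powr p * cmod (f w) powr p
      \<le> (\<Sum>x\<in>level adj r m. \<sigma> x powr p * cmod (f x) powr p)"
    using w fin by (intro member_le_sum) (auto simp: m_def)
  ultimately show ?thesis
    by (simp add: m_def)
qed

theorem theorem6:
  fixes adj :: "'v \<Rightarrow> 'v \<Rightarrow> bool" and r :: 'v
    and \<sigma>\<^sub>1 \<sigma>\<^sub>2 :: "'v \<Rightarrow> real" and \<phi> :: "'v \<Rightarrow> 'v" and \<psi> :: "'v \<Rightarrow> complex"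
    and p :: real and v :: "nat \<Rightarrow> nat \<Rightarrow> 'v"
  defines "D \<equiv> level adj r" and "c \<equiv> level_card adj r"
    and "X \<equiv> T_norm adj r \<sigma>\<^sub>1 p" and "Y \<equiv> T_norm adj r \<sigma>\<^sub>2 p"
    and "W \<equiv> weighted_comp \<psi> \<phi>"
  assumes "is_tree adj" and "infinite (UNIV :: 'v set)"
    and "\<And>n. finite (D n)" and "\<not> bdd_above (range c)"
    and "weight_function \<sigma>\<^sub>1" and "weight_function \<sigma>\<^sub>2" and "0 < p"
    and "\<And>m n. v m n \<in> D m"
    and "\<And>m n. preimage_count adj r \<phi> n (v m n) = max_preimage_count adj r \<phi> m n"
  shows
    "(bounded_operator X Y W \<longrightarrow>
        (SUP n. ereal (1 / real (c n) *
           (\<Sum>m\<in>image_levels adj r \<phi> n. \<Sum>x\<in>{x \<in> D n. \<phi> x = v m n}.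
              cmod (of_real (\<sigma>\<^sub>2 x) * \<psi> x / of_real (\<sigma>\<^sub>1 (\<phi> x))) powr p * real (c m))))
          \<le> ereal (operator_norm X Y W powr p)) \<and>
     (\<forall>M. M = (SUP n. ereal (1 / real (c n) *
           (\<Sum>m\<in>image_levels adj r \<phi> n. \<Sum>x\<in>{x \<in> D n. depth adj r (\<phi> x) = m}.
              cmod (of_real (\<sigma>\<^sub>2 x) * \<psi> x / of_real (\<sigma>\<^sub>1 (\<phi> x))) powr p * real (c m)))) \<and>
          M < \<infinity> \<longrightarrow>
        bounded_operator X Y W \<and> ereal (operator_norm X Y W powr p) \<le> M)"
proof -
  note \<sigma>1 = assms(10) and \<sigma>2 = assms(11) and p = assms(12)
  have fin: "finite (level adj r n)" for n
    using assms(8) by (simp add: D_def)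
  have v: "v m n \<in> level adj r m" for m n
    using assms(13) by (simp add: D_def)
  define u where "u = (\<lambda>x. cmod (of_real (\<sigma>\<^sub>2 x) * \<psi> x / of_real (\<sigma>\<^sub>1 (\<phi> x))) powr p)"
  \<comment> \<open>The chosen vertices depend on n, so each n gets its own test function, used only
    for the n-th term of the supremum.\<close>
  define f where "f n = transversal_fun adj r \<sigma>\<^sub>1 p (\<lambda>m. v m n)" for n
  have Xf: "X (f n) = 1" for n
    unfolding X_def f_def by (rule T_norm_transversal_fun[OF \<sigma>1 p fin v])
  have f_in: "f n \<in> fspace X" for n
    by (simp add: fspace_def Xf)
  have f_pos: "0 < X (f 0)"
    by (simp add: Xf)
  have mean_W: "level_mean adj r \<sigma>\<^sub>2 p n (W g) powr p = 1 / real (c n) *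
      (\<Sum>m\<in>image_levels adj r \<phi> n. \<Sum>x\<in>{x \<in> D n. depth adj r (\<phi> x) = m}.
        u x * (\<sigma>\<^sub>1 (\<phi> x) powr p * cmod (g (\<phi> x)) powr p))" for g n
    unfolding W_def c_def D_def u_def by (rule level_mean_weighted_comp[OF \<sigma>1 \<sigma>2 p fin])
  have least: "op_bound X Y W (operator_norm X Y W)" "0 \<le> operator_norm X Y W"
    "\<And>C. op_bound X Y W C \<Longrightarrow> operator_norm X Y W \<le> C"
    if "op_bound X Y W C0" for C0
    using operator_norm_least[of X Y "f 0" W C0, OF _ _ f_in f_pos that]
    by (auto simp: X_def Y_def T_norm_nonneg)

  have lower: "(SUP n. ereal (1 / real (c n) * (\<Sum>m\<in>image_levels adj r \<phi> n.
      \<Sum>x\<in>{x \<in> D n. \<phi> x = v m n}. u x * real (c m)))) \<le> ereal (operator_norm X Y W powr p)"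
    if W: "bounded_operator X Y W"
  proof (rule SUP_least)
    fix n
    obtain C0 where C0: "op_bound X Y W C0"
      using W by (auto simp: bounded_operator_def)
    \<comment> \<open>The test function has norm 1, so the factor \<open>X (f n)\<close> disappears
      from the operator bound.\<close>
    have "Y (W (f n)) \<le> ereal (operator_norm X Y W)"
      using least(1)[OF C0] f_in[of n] Xf[of n] by (auto simp: op_bound_def)
    then have "level_mean adj r \<sigma>\<^sub>2 p n (W (f n)) \<le> operator_norm X Y W"
      using level_mean_le_T_norm[of adj r \<sigma>\<^sub>2 p n "W (f n)"] unfolding Y_def
      by (meson ereal_less_eq(3) order_trans)
    then have "level_mean adj r \<sigma>\<^sub>2 p n (W (f n)) powr p \<le> operator_norm X Y W powr p"
      using p level_mean_nonneg by (intro powr_mono2) auto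
    \<comment> \<open>Among the x with |\<phi>(x)| = m, the test function at \<phi>(x) vanishes
      unless \<phi>(x) = \<open>v m n\<close>, where its weighted p-th power is
      \<open>c m\<close>.\<close>
    moreover have "(\<Sum>x\<in>{x \<in> D n. \<phi> x = v m n}. u x * real (c m)) =
        (\<Sum>x\<in>{x \<in> D n. depth adj r (\<phi> x) = m}.
          u x * (\<sigma>\<^sub>1 (\<phi> x) powr p * cmod (f n (\<phi> x)) powr p))" for m
    proof (rule sum.mono_neutral_cong_left)
      show "finite {x \<in> D n. depth adj r (\<phi> x) = m}"
        using fin by (simp add: D_def)
      show "{x \<in> D n. \<phi> x = v m n} \<subseteq> {x \<in> D n. depth adj r (\<phi> x) = m}"
        using v[of m n] by (auto simp: level_def)
      show "\<forall>x\<in>{x \<in> D n. depth adj r (\<phi> x) = m} - {x \<in> D n. \<phi> x = v m n}.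
          u x * (\<sigma>\<^sub>1 (\<phi> x) powr p * cmod (f n (\<phi> x)) powr p) = 0"
        by (auto simp: f_def transversal_fun_def)
      show "u x * real (c m) = u x * (\<sigma>\<^sub>1 (\<phi> x) powr p * cmod (f n (\<phi> x)) powr p)"
        if "x \<in> {x \<in> D n. \<phi> x = v m n}" for x
        using that v[of m n] by (auto simp: f_def transversal_fun_powr[OF \<sigma>1 p] c_def level_def)
    qed
    ultimately show "ereal (1 / real (c n) * (\<Sum>m\<in>image_levels adj r \<phi> n.
        \<Sum>x\<in>{x \<in> D n. \<phi> x = v m n}. u x * real (c m))) \<le> ereal (operator_norm X Y W powr p)"
      by (simp add: mean_W)
  qed

  have upper: "bounded_operator X Y W \<and> ereal (operator_norm X Y W powr p) \<le> M"
    if M_eq: "M = (SUP n. ereal (1 / real (c n) * (\<Sum>m\<in>image_levels adj r \<phi> n.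
        \<Sum>x\<in>{x \<in> D n. depth adj r (\<phi> x) = m}. u x * real (c m))))"
      and M_fin: "M < \<infinity>" for M
  proof -
    define S where "S n = 1 / real (c n) * (\<Sum>m\<in>image_levels adj r \<phi> n.
        \<Sum>x\<in>{x \<in> D n. depth adj r (\<phi> x) = m}. u x * real (c m))" for n
    have S_nonneg: "0 \<le> S n" for n
      by (auto simp: S_def u_def intro!: mult_nonneg_nonneg divide_nonneg_nonneg sum_nonneg)
    have S_le: "ereal (S n) \<le> M" for n
      unfolding M_eq S_def by (rule SUP_upper) simp
    \<comment> \<open>The term for n = 0 keeps \<open>M\<close> away from minus infinity, so
      finiteness from above makes it real.\<close>
    obtain K where K: "M = ereal K"
      using M_fin S_le[of 0] by (cases M) auto
    have K_nonneg: "0 \<le> K"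
      using S_nonneg[of 0] S_le[of 0] K by simp
    \<comment> \<open>The estimates run on p-th powers, where the constant is \<open>K\<close>; its
      p-th root is therefore the bound for the operator.\<close>
    have bound: "op_bound X Y W (K powr (1 / p))"
      unfolding op_bound_def
    proof
      fix g assume g: "g \<in> fspace X"
      then obtain F where F: "X g = ereal F" "0 \<le> F"
        using T_norm_nonneg[of adj r \<sigma>\<^sub>1 p g]
        by (cases "X g") (auto simp: fspace_def X_def)
      have "level_mean adj r \<sigma>\<^sub>2 p n (W g) \<le> K powr (1 / p) * F" for n
      proof -
        \<comment> \<open>Bounding the second factor by \<open>c m\<close> times
          \<open>F powr p\<close> leaves a constant \<open>F powr p\<close> that can be pulled out
          of both sums; what remains is \<open>S n\<close>.\<close>
        have "level_mean adj r \<sigma>\<^sub>2 p n (W g) powr p \<le> 1 / real (c n) *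
            (\<Sum>m\<in>image_levels adj r \<phi> n. \<Sum>x\<in>{x \<in> D n. depth adj r (\<phi> x) = m}.
              u x * (real (c m) * F powr p))"
          unfolding mean_W
        proof (intro mult_left_mono sum_mono)
          fix m x assume "x \<in> {x \<in> D n. depth adj r (\<phi> x) = m}"
          then show "\<sigma>\<^sub>1 (\<phi> x) powr p * cmod (g (\<phi> x)) powr p \<le> real (c m) * F powr p"
            using level_term_le[OF p fin, where w = "\<phi> x" and f = g and F = F and \<sigma> = \<sigma>\<^sub>1] F(1)
            by (auto simp: X_def c_def)
        qed (auto simp: u_def)
        also have "\<dots> = S n * F powr p"
          by (simp add: S_def sum_distrib_left sum_distrib_right sum_divide_distrib mult_ac)
        also have "\<dots> \<le> K * F powr p"
          using S_le[of n] K by (intro mult_right_mono) auto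
        also have "\<dots> = (K powr (1 / p) * F) powr p"
          using p K_nonneg F(2) by (simp add: powr_mult powr_powr)
        \<comment> \<open>Both bases are nonnegative and p > 0, so the p-th powers can be cancelled
          by strict monotonicity.\<close>
        finally show ?thesis
          using p F(2) level_mean_nonneg[of adj r \<sigma>\<^sub>2 p n "W g"]
          by (meson mult_nonneg_nonneg not_le powr_ge_zero powr_less_mono2)
      qed
      then show "Y (W g) \<le> ereal (K powr (1 / p)) * X g"
        unfolding F Y_def T_norm_def by (auto intro: SUP_least)
    qed
    have "W ` fspace X \<subseteq> fspace Y"
    proof
      fix h assume "h \<in> W ` fspace X"
      then obtain g where g: "g \<in> fspace X" "h = W g" by auto
      then have "Y h \<le> ereal (K powr (1 / p)) * X g"
        using bound by (auto simp: op_bound_def)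
      also have "\<dots> < \<infinity>"
        using g(1) T_norm_nonneg[of adj r \<sigma>\<^sub>1 p g]
        by (cases "X g") (auto simp: fspace_def X_def)
      finally show "h \<in> fspace Y" by (simp add: fspace_def)
    qed
    then have "bounded_operator X Y W"
      using bound by (auto simp: bounded_operator_def W_def linear_on_fspace_weighted_comp)
    \<comment> \<open>Minimality compares the norm with the bound just found; nonnegativity of the
      norm allows raising to the power p.\<close>
    moreover have "operator_norm X Y W powr p \<le> (K powr (1 / p)) powr p"
      using least(2,3)[OF bound] bound p by (intro powr_mono2) auto
    then have "operator_norm X Y W powr p \<le> K"
      using p K_nonneg by (simp add: powr_powr)
    ultimately show ?thesis
      by (simp add: K)
  qed
  show ?thesis
    using lower upper unfolding u_def by blast
qed

end
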